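(* Let $G=\langle S\mid R\rangle$ be a finitely generated group with fixed finite generating set $S$, all of whose relators in $R$ have even length. Let $\mathrm{St}(G,S)$ be a language of words over $S\cup S^{-1}$ (standard representatives) that contains, for each element of $G$, a word representing it. Suppose that every word of $\mathrm{St}(G,S)$ is geodesic and that every word of $\mathrm{St}(G,S)$ is a prefix of another (different) word of $\mathrm{St}(G,S)$. Then $G$ has no dead ends with respect to $S$.
   Context: For $g\in G$, $l(g)$ denotes the length of a shortest word over $S\cup S^{-1}$ representing $g$. A word is geodesic if its length equals $l(g)$, where $g$ is the element it represents. An element $g\in G$ is a dead end (with respect to $S$) if $l(gs)\le l(g)$ for all $s\in S\cup S^{-1}$. *)

theory Defs
  imports "HOL-Algebra.Generated_Groups" "HOL-Library.Sublist"
begin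

datatype 'a letter = Pos 'a | Neg 'a

primrec flip :: "'a letter \<Rightarrow> 'a letter" where
  "flip (Pos a) = Neg a"
| "flip (Neg a) = Pos a"

definition letters :: "'a set \<Rightarrow> 'a letter set" where
  "letters S = Pos ` S \<union> Neg ` S"

text \<open>Words are not required to be freely reduced.\<close>

abbreviation "words S \<equiv> lists (letters S)"

fun push :: "'a letter \<Rightarrow> 'a letter list \<Rightarrow> 'a letter list" where
  "push x [] = [x]"
| "push x (y # ys) = (if y = flip x then ys else x # y # ys)"

definition red :: "'a letter list \<Rightarrow> 'a letter list" where
  "red w = foldr push w []"

definition reduced :: "'a letter list \<Rightarrow> bool" where
  "reduced w \<longleftrightarrow> (\<forall>i. Suc i < length w \<longrightarrow> w ! Suc i \<noteq> flip (w ! i))"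

definition free_group :: "'a set \<Rightarrow> 'a letter list monoid" where
  "free_group S =
     \<lparr> carrier = {w \<in> words S. reduced w}, mult = (\<lambda>u v. red (u @ v)), one = [] \<rparr>"

lemma flip_flip [simp]: "flip (flip x) = x"
  by (cases x) auto

lemma flip_neq [simp]: "flip x \<noteq> x" "x \<noteq> flip x"
  by (cases x; auto)+

lemma flip_letters [simp]: "flip x \<in> letters S \<longleftrightarrow> x \<in> letters S"
  by (cases x) (auto simp: letters_def)

lemma reduced_Nil [simp]: "reduced []"
  and reduced_single [simp]: "reduced [x]"
  and reduced_Cons2 [simp]: "reduced (x # y # ys) \<longleftrightarrow> y \<noteq> flip x \<and> reduced (y # ys)"
  unfolding reduced_def by (auto simp: nth_Cons split: nat.splits)

lemma reduced_ConsD: "reduced (x # ys) \<Longrightarrow> reduced ys"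
  by (cases ys) auto

lemma reduced_push: "reduced w \<Longrightarrow> reduced (push x w)"
  by (cases w) (auto dest: reduced_ConsD)

lemma words_push: "x \<in> letters S \<Longrightarrow> w \<in> words S \<Longrightarrow> push x w \<in> words S"
  by (cases w) auto

lemma push_flip: "reduced w \<Longrightarrow> push x (push (flip x) w) = w"
proof (cases w)
  case (Cons y ys)
  moreover assume "reduced w"
  ultimately show ?thesis by (cases ys) auto
qed auto

lemma push_reduced: "reduced (x # w) \<Longrightarrow> push x w = x # w"
  by (cases w) auto

lemma foldr_push_reduced: "reduced w \<Longrightarrow> reduced (foldr push u w)"
  by (induction u) (auto intro: reduced_push)

lemma foldr_push_words: "u \<in> words S \<Longrightarrow> w \<in> words S \<Longrightarrow> foldr push u w \<in> words S"
  by (induction u) (simp_all add: words_push del: in_lists_conv_set)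

lemma red_reduced: "reduced (red w)"
  unfolding red_def by (rule foldr_push_reduced) simp

lemma red_words: "w \<in> words S \<Longrightarrow> red w \<in> words S"
  unfolding red_def by (rule foldr_push_words) auto

lemma red_id: "reduced w \<Longrightarrow> red w = w"
  unfolding red_def
  proof (induction w)
  case (Cons x w)
  then show ?case using push_reduced[of x w] reduced_ConsD[of x w] by simp
qed simp

lemma foldr_push_push:
  "reduced w \<Longrightarrow> foldr push (push x t) w = push x (foldr push t w)"
proof (cases t)
  case (Cons y t')
  assume "reduced w"
  then have "push x (push (flip x) (foldr push t' w)) = foldr push t' w"
    by (intro push_flip foldr_push_reduced)
  with Cons show ?thesis by auto
qed auto

lemma foldr_push_red: "reduced w \<Longrightarrow> foldr push (red u) w = foldr push u w"
  unfolding red_def by (induction u) (auto simp: foldr_push_push)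

lemma red_append_red_left: "red (red u @ v) = red (u @ v)"
  using foldr_push_red[of "foldr push v []" u] foldr_push_reduced[of "[]" v]
  by (simp add: red_def)

lemma red_append_red_right: "red (u @ red v) = red (u @ v)"
  using red_id[OF red_reduced[of v]] by (simp add: red_def)

lemma red_inverse: "red (rev (map flip u) @ u) = []"
proof (induction u rule: rev_induct)
  case (snoc x u)
  have "red (flip x # (rev (map flip u) @ u) @ [x]) = push (flip x) (red ((rev (map flip u) @ u) @ [x]))"
    by (simp add: red_def)
  also have "red ((rev (map flip u) @ u) @ [x]) = red (red (rev (map flip u) @ u) @ [x])"
    by (rule red_append_red_left [symmetric])
  also have "\<dots> = [x]"
    using snoc by (simp add: red_def)
  finally show ?case by simp
qed (simp add: red_def)

lemma words_rev_flip: "u \<in> words S \<Longrightarrow> rev (map flip u) \<in> words S"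
  by (auto simp: in_lists_conv_set)

lemma group_free_group: "group (free_group S)"
proof (rule groupI)
  fix x y z
  assume xyz: "x \<in> carrier (free_group S)" "y \<in> carrier (free_group S)" "z \<in> carrier (free_group S)"
  show "x \<otimes>\<^bsub>free_group S\<^esub> y \<in> carrier (free_group S)"
    using xyz red_words[of "x @ y" S] by (auto simp: free_group_def red_reduced)
  show "x \<otimes>\<^bsub>free_group S\<^esub> y \<otimes>\<^bsub>free_group S\<^esub> z = x \<otimes>\<^bsub>free_group S\<^esub> (y \<otimes>\<^bsub>free_group S\<^esub> z)"
    by (simp add: free_group_def red_append_red_left red_append_red_right)
next
  fix x assume x: "x \<in> carrier (free_group S)"
  show "\<exists>y\<in>carrier (free_group S). y \<otimes>\<^bsub>free_group S\<^esub> x = \<one>\<^bsub>free_group S\<^esub>"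
  proof (rule bexI)
    show "red (rev (map flip x)) \<in> carrier (free_group S)"
      using x by (auto simp only: free_group_def partial_object.simps mem_Collect_eq
          intro!: red_reduced red_words words_rev_flip)
    show "red (rev (map flip x)) \<otimes>\<^bsub>free_group S\<^esub> x = \<one>\<^bsub>free_group S\<^esub>"
      by (simp add: free_group_def red_append_red_left red_inverse)
  qed
qed (auto simp: free_group_def red_id)

definition normal_closure :: "('g, 'm) monoid_scheme \<Rightarrow> 'g set \<Rightarrow> 'g set" where
  "normal_closure G X = \<Inter>{N. N \<lhd> G \<and> X \<subseteq> N}"

definition relator_closure :: "'a set \<Rightarrow> 'a letter list set \<Rightarrow> 'a letter list set" where
  "relator_closure S R = normal_closure (free_group S) (red ` R)"

definition presented_group :: "'a set \<Rightarrow> 'a letter list set \<Rightarrow> 'a letter list set monoid" where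
  "presented_group S R = free_group S Mod relator_closure S R"

text \<open>
  \<open>has_presentation G \<iota> S R\<close> says that G is the group presented by generators S and relators R,
  with \<open>\<iota>\<close> sending a generator symbol to the element it denotes. The map \<open>\<iota>\<close> need not be
  injective. For a generating subset S of G itself, take \<open>\<iota>\<close> to be the identity.
\<close>

definition has_presentation ::
  "('g, 'm) monoid_scheme \<Rightarrow> ('a \<Rightarrow> 'g) \<Rightarrow> 'a set \<Rightarrow> 'a letter list set \<Rightarrow> bool" where
  "has_presentation G \<iota> S R \<longleftrightarrow>
     group G \<and> R \<subseteq> words S \<and>
     (\<exists>h \<in> iso (presented_group S R) G.
        \<forall>s\<in>S. h (relator_closure S R #>\<^bsub>free_group S\<^esub> [Pos s]) = \<iota> s)"

lemma normal_normal_closure: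
  assumes "group G" "X \<subseteq> carrier G"
  shows "normal_closure G X \<lhd> G"
proof -
  interpret group G by fact
  have car: "carrier G \<lhd> G"
    by (rule normal_invI[OF subgroup_self]) auto
  have "subgroup (\<Inter>{N. N \<lhd> G \<and> X \<subseteq> N}) G"
    by (rule subgroups_Inter) (use car assms in \<open>auto dest: normal_imp_subgroup\<close>)
  then show ?thesis
    unfolding normal_closure_def
    by (rule normal_invI) (use normal_inv_iff in auto)
qed

lemma normal_relator_closure:
  assumes "R \<subseteq> words S"
  shows "relator_closure S R \<lhd> free_group S"
  unfolding relator_closure_def
proof (rule normal_normal_closure[OF group_free_group])
  show "red ` R \<subseteq> carrier (free_group S)"
    using assms red_words red_reduced by (fastforce simp: free_group_def)
qed

lemma has_presentation_presented_group:
  assumes "R \<subseteq> words S"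
  shows "has_presentation (presented_group S R)
           (\<lambda>s. relator_closure S R #>\<^bsub>free_group S\<^esub> [Pos s]) S R"
  unfolding has_presentation_def
  using assms normal.factorgroup_is_group[OF normal_relator_closure[OF assms]] iso_set_refl
  by (fastforce simp: presented_group_def)

primrec letter_value :: "('g, 'm) monoid_scheme \<Rightarrow> ('a \<Rightarrow> 'g) \<Rightarrow> 'a letter \<Rightarrow> 'g" where
  "letter_value G \<iota> (Pos a) = \<iota> a"
| "letter_value G \<iota> (Neg a) = inv\<^bsub>G\<^esub> (\<iota> a)"

definition word_value :: "('g, 'm) monoid_scheme \<Rightarrow> ('a \<Rightarrow> 'g) \<Rightarrow> 'a letter list \<Rightarrow> 'g" where
  "word_value G \<iota> w = foldr (\<lambda>x g. letter_value G \<iota> x \<otimes>\<^bsub>G\<^esub> g) w \<one>\<^bsub>G\<^esub>"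

definition word_length :: "('g, 'm) monoid_scheme \<Rightarrow> ('a \<Rightarrow> 'g) \<Rightarrow> 'a set \<Rightarrow> 'g \<Rightarrow> nat" where
  "word_length G \<iota> S g = (LEAST n. \<exists>w\<in>words S. word_value G \<iota> w = g \<and> length w = n)"

definition geodesic :: "('g, 'm) monoid_scheme \<Rightarrow> ('a \<Rightarrow> 'g) \<Rightarrow> 'a set \<Rightarrow> 'a letter list \<Rightarrow> bool" where
  "geodesic G \<iota> S w \<longleftrightarrow> w \<in> words S \<and> length w = word_length G \<iota> S (word_value G \<iota> w)"

definition dead_end :: "('g, 'm) monoid_scheme \<Rightarrow> ('a \<Rightarrow> 'g) \<Rightarrow> 'a set \<Rightarrow> 'g \<Rightarrow> bool" where
  "dead_end G \<iota> S g \<longleftrightarrow>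
     g \<in> carrier G \<and>
     (\<forall>x\<in>letters S. word_length G \<iota> S (g \<otimes>\<^bsub>G\<^esub> letter_value G \<iota> x) \<le> word_length G \<iota> S g)"

end

theory Submission
  imports Defs
begin

text \<open>
  Prefixes of geodesic words are geodesic. Hence if a standard representative \<open>w\<close> of \<open>g\<close> extends to a
  longer standard representative whose next letter is \<open>x\<close>, then \<open>w @ [x]\<close> is geodesic, so \<open>g x\<close> is
  strictly longer than \<open>g\<close>.
\<close>

text \<open>The definition of \<open>has_presentation\<close> does not state this directly. It
  follows because \<open>\<iota> s\<close> is the image under the isomorphism \<open>h\<close> of
  the coset of the one-letter word \<open>[Pos s]\<close>, which is reduced and so lies in the free
  group.\<close>

lemma has_presentation_generator_closed:
  assumes "has_presentation G \<iota> S R" and "s \<in> S"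
  shows "\<iota> s \<in> carrier G"
proof -
  obtain h where h: "h \<in> iso (presented_group S R) G"
    and gen: "h (relator_closure S R #>\<^bsub>free_group S\<^esub> [Pos s]) = \<iota> s"
    using assms unfolding has_presentation_def by blast
  have "[Pos s] \<in> carrier (free_group S)"
    using assms(2) by (simp add: free_group_def letters_def)
  then have "relator_closure S R #>\<^bsub>free_group S\<^esub> [Pos s] \<in> carrier (presented_group S R)"
    by (auto simp: presented_group_def FactGroup_def RCOSETS_def)
  then show ?thesis
    using h gen by (metis iso_imp_homomorphism hom_in_carrier)
qed

lemma word_length_le:
  "u \<in> words S \<Longrightarrow> word_length G \<iota> S (word_value G \<iota> u) \<le> length u"
  unfolding word_length_def by (rule Least_le) blast

text \<open>The word \<open>u\<close> itself shows that the set of lengths under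
  \<open>LEAST\<close> is nonempty, so the minimum is a genuine one.\<close>

lemma word_length_attained:
  assumes "u \<in> words S"
  obtains v where "v \<in> words S" "word_value G \<iota> v = word_value G \<iota> u"
    "length v = word_length G \<iota> S (word_value G \<iota> u)"
  using LeastI_ex[of "\<lambda>n. \<exists>w\<in>words S. word_value G \<iota> w = word_value G \<iota> u \<and> length w = n"] assms
  unfolding word_length_def by blast

context group
begin

lemma letter_value_closed:
  assumes "\<iota> ` S \<subseteq> carrier G" and "x \<in> letters S"
  shows "letter_value G \<iota> x \<in> carrier G"
  using assms by (auto simp: letters_def)

lemma word_value_closed:
  assumes "\<iota> ` S \<subseteq> carrier G" and "u \<in> words S"
  shows "word_value G \<iota> u \<in> carrier G"
  using assms(2) by induction (auto simp: word_value_def letter_value_closed[OF assms(1)])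

text \<open>Associativity and the unit law are available only inside the carrier, hence the closure
  hypotheses on \<open>\<iota>\<close> and on both words.\<close>

lemma word_value_append:
  assumes "\<iota> ` S \<subseteq> carrier G" and "u \<in> words S" and "v \<in> words S"
  shows "word_value G \<iota> (u @ v) = word_value G \<iota> u \<otimes> word_value G \<iota> v"
  using assms(2)
proof induction
  case Nil
  then show ?case
    using word_value_closed[OF assms(1,3)] by (simp add: word_value_def)
next
  case (Cons x u)
  \<comment> \<open>Stated for arbitrary \<open>y\<close> and \<open>z\<close> so that it peels the
    first letter off both \<open>x # u\<close> and \<open>x # (u @ v)\<close>.\<close>
  have "word_value G \<iota> (y # z) = letter_value G \<iota> y \<otimes> word_value G \<iota> z" for y z
    by (simp add: word_value_def)
  then show ?case
    using Cons letter_value_closed[OF assms(1)] word_value_closed[OF assms(1)] assms(3)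
    by (simp add: m_assoc del: in_lists_conv_set)
qed

text \<open>A shorter word for the value of \<open>u\<close> could be substituted for
  \<open>u\<close> inside \<open>w\<close>, giving a word for the same element shorter than
  \<open>w\<close>.\<close>

lemma geodesic_prefix:
  assumes "\<iota> ` S \<subseteq> carrier G" and "geodesic G \<iota> S w" and "prefix u w"
  shows "geodesic G \<iota> S u"
proof -
  obtain v where w: "w = u @ v"
    using assms(3) by (auto elim: prefixE)
  have u: "u \<in> words S" and v: "v \<in> words S"
    and len: "length w = word_length G \<iota> S (word_value G \<iota> w)"
    using assms(2) by (auto simp: geodesic_def w)
  \<comment> \<open>\<open>t\<close> is a shortest competitor of \<open>u\<close>; comparing
    \<open>w = u @ v\<close> with \<open>t @ v\<close> and cancelling the length of \<open>v\<close>
    bounds \<open>u\<close> by \<open>t\<close>.\<close>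
  obtain t where t: "t \<in> words S" "word_value G \<iota> t = word_value G \<iota> u"
      "length t = word_length G \<iota> S (word_value G \<iota> u)"
    using word_length_attained[OF u] .
  have "word_value G \<iota> (t @ v) = word_value G \<iota> w"
    using word_value_append[OF assms(1)] t(1,2) u v by (simp add: w del: in_lists_conv_set)
  then have "length w \<le> length (t @ v)"
    using word_length_le[of "t @ v" S G \<iota>] t(1) v len by simp
  then have "length u \<le> length t"
    by (simp add: w)
  then show ?thesis
    using word_length_le[OF u, of G \<iota>] t(3) u by (simp add: geodesic_def)
qed

end

theorem theorem4:
  fixes G :: "('g, 'm) monoid_scheme"
    and \<iota> :: "'a \<Rightarrow> 'g"
    and S :: "'a set"
    and R St :: "'a letter list set"
  assumes "finite S"
    and "has_presentation G \<iota> S R"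
    and "\<forall>r\<in>R. even (length r)"
    and "St \<subseteq> words S"
    and "\<forall>g\<in>carrier G. \<exists>w\<in>St. word_value G \<iota> w = g"
    and "\<forall>w\<in>St. geodesic G \<iota> S w"
    and "\<forall>w\<in>St. \<exists>w'\<in>St. w' \<noteq> w \<and> prefix w w'"
  shows "\<not> (\<exists>g. dead_end G \<iota> S g)"
proof
  assume "\<exists>g. dead_end G \<iota> S g"
  then obtain g where g: "g \<in> carrier G"
    and dead: "\<And>x. x \<in> letters S \<Longrightarrow>
      word_length G \<iota> S (g \<otimes>\<^bsub>G\<^esub> letter_value G \<iota> x) \<le> word_length G \<iota> S g"
    unfolding dead_end_def by blast
  interpret group G
    using assms(2) by (simp add: has_presentation_def)
  have gens: "\<iota> ` S \<subseteq> carrier G"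
    using has_presentation_generator_closed[OF assms(2)] by blast
  obtain w where w: "w \<in> St" "word_value G \<iota> w = g"
    using assms(5) g by blast
  obtain w' where w': "w' \<in> St" "strict_prefix w w'"
    using assms(7) w(1) by (auto simp: strict_prefix_def)
  \<comment> \<open>Since \<open>w'\<close> differs from \<open>w\<close>, the prefix is strict and
    there is a next letter \<open>x\<close>.\<close>
  then obtain x u where "w' = w @ x # u"
    by (auto elim: strict_prefixE')
  then have "prefix (w @ [x]) w'"
    by simp
  then have geo: "geodesic G \<iota> S (w @ [x])"
    using geodesic_prefix[OF gens] assms(6) w'(1) by blast
  then have x: "x \<in> letters S" and "w \<in> words S"
    by (auto simp: geodesic_def)
  then have "word_value G \<iota> (w @ [x]) = g \<otimes>\<^bsub>G\<^esub> letter_value G \<iota> x"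
    using word_value_append[OF gens, of w "[x]"] letter_value_closed[OF gens x] w(2)
    by (simp add: word_value_def)
  \<comment> \<open>Both \<open>w @ [x]\<close> and \<open>w\<close> are geodesic, so appending
    \<open>x\<close> raises the length of \<open>g\<close> by exactly one, against the dead end
    inequality at \<open>x\<close>.\<close>
  then have "length w + 1 = word_length G \<iota> S (g \<otimes>\<^bsub>G\<^esub> letter_value G \<iota> x)"
    using geo by (simp add: geodesic_def)
  moreover have "length w = word_length G \<iota> S g"
    using assms(6) w by (auto simp: geodesic_def)
  ultimately show False
    using dead[OF x] by simp
qed

end
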